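(* Let $\alpha = \{k_1, \ldots, k_p\}$, $\beta = \{l_1, \ldots, l_q\}$ and $\gamma = \{n_1,n_2\}$ be three partitions of $n$, i.e. $\sum_{i=1}^p k_i = \sum_{i=1}^q l_i =n_1 + n_2 = n$, with $\alpha \sqsubseteq \beta$ ($\alpha$ is a sub-partition of $\beta$). Let $\mathbf{1}=\{1,\ldots,1\}$ denote the trivial partition of $n$. Then $$ \mathcal{FW}^n_2 = \mathcal{FW}_{\mathbf{1},2}^n \subseteq \mathcal{FW}_{\alpha,2}^n \subseteq \mathcal{FW}_{\beta,2}^n \subseteq \mathcal{FW}_{\gamma,2}^n = \mathbb{S}^n_{+}, $$ and $$ \mathbb{S}^n_{+} = (\mathcal{FW}_{\gamma,2}^n)^* \subseteq (\mathcal{FW}_{\beta,2}^n)^* \subseteq (\mathcal{FW}_{\alpha,2}^n)^* \subseteq (\mathcal{FW}_{\mathbf{1},2}^n)^*. $$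
   Context: $\mathbb{S}^n$ denotes the real symmetric $n\times n$ matrices and $\mathbb{S}^n_+$ the positive semidefinite (PSD) ones. A partition of $n$ is an ordered list $\alpha=\{k_1,\ldots,k_p\}$ of positive integers with $\sum_{i=1}^p k_i=n$; throughout, every partition has at least two blocks. Sub-partition: given partitions $\{a_1,\ldots,a_s\}$ and $\{b_1,\ldots,b_t\}$ of $n$ with $s<t$, we write $\{b_1,\ldots,b_t\}\sqsubseteq\{a_1,\ldots,a_s\}$ (the former is a sub-partition of the latter) if there are integers $1=m_1<m_2<\cdots<m_{s+1}=t+1$ with $a_i=\sum_{j=m_i}^{m_{i+1}-1} b_j$ for all $i=1,\ldots,s$. Let $E_i^\alpha\in\mathbb{R}^{k_i\times n}$ be the $i$-th block row of $I_n$ when the rows of $I_n$ are split consecutively into blocks of sizes $k_1,\ldots,k_p$, and for $i\neq j$ let $E_{ij}^\alpha=\begin{bmatrix}(E_i^\alpha)^{\mathsf T} & (E_j^\alpha)^{\mathsf T}\end{bmatrix}^{\mathsf T}\in\mathbb{R}^{(k_i+k_j)\times n}$. The set $\mathcal{FW}_{\alpha,2}^n$ of block factor-width-two matrices consists of all $Z\in\mathbb{S}^n$ of the form $Z=\sum_{i=1}^{p-1}\sum_{j=i+1}^p (E^{\alpha}_{ij})^{\mathsf T} X_{ij} E^{\alpha}_{ij}$ for some $X_{ij}\in\mathbb{S}^{k_i+k_j}_+$. $\mathcal{FW}_2^n$ is the set of $n\times n$ matrices of factor width at most two, i.e. matrices $VV^{\mathsf T}$ for some real matrix $V$ each of whose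 columns has at most $2$ nonzero entries. The dual of a cone $K\subseteq\mathbb{S}^n$ is $K^*=\{X\in\mathbb{S}^n\mid \mathrm{tr}(XZ)\ge 0\ \forall Z\in K\}$. *)

theory Defs
  imports Complex_Main "Jordan_Normal_Form.Matrix"
begin

definition is_partition :: "nat \<Rightarrow> nat list \<Rightarrow> bool" where
  "is_partition n ks \<longleftrightarrow> 2 \<le> length ks \<and> (\<forall>k\<in>set ks. 0 < k) \<and> sum_list ks = n"

text \<open>The relation is strict: \<open>sub_partition bs as\<close> requires that \<open>bs\<close> has more blocks than
  \<open>as\<close>. The cut points are 0-based, so \<open>m i\<close> here is \<open>m\<^sub>i\<^sub>+\<^sub>1 - 1\<close> in the usual 1-based convention.\<close>

definition sub_partition :: "nat list \<Rightarrow> nat list \<Rightarrow> bool" where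
  "sub_partition bs as \<longleftrightarrow> length as < length bs \<and>
     (\<exists>m :: nat \<Rightarrow> nat. m 0 = 0 \<and> m (length as) = length bs \<and>
        (\<forall>i < length as. m i < m (i + 1)) \<and>
        (\<forall>i < length as. as ! i = (\<Sum>j = m i..<m (i + 1). bs ! j)))"

definition sym_mats :: "nat \<Rightarrow> real mat set" where
  "sym_mats n = {X \<in> carrier_mat n n. X\<^sup>T = X}"

definition psd_mats :: "nat \<Rightarrow> real mat set" where
  "psd_mats n = {X \<in> sym_mats n. \<forall>v \<in> carrier_vec n. 0 \<le> v \<bullet> (X *\<^sub>v v)}"

definition block_row :: "nat \<Rightarrow> nat list \<Rightarrow> nat \<Rightarrow> real mat" where
  "block_row n ks i = mat (ks ! i) n (\<lambda>(r, c). 1\<^sub>m n $$ (sum_list (take i ks) + r, c))"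

definition block_row_pair :: "nat \<Rightarrow> nat list \<Rightarrow> nat \<Rightarrow> nat \<Rightarrow> real mat" where
  "block_row_pair n ks i j = block_row n ks i @\<^sub>r block_row n ks j"

text \<open>Blocks are indexed from 0, so the pairs are \<open>0 \<le> i < j < p\<close> with \<open>p = length ks\<close>. The sums are
  taken in the additive structure of \<open>n \<times> n\<close> matrices, because the type \<open>real mat\<close> contains
  matrices of all dimensions and has no zero.\<close>

definition block_fw2 :: "nat \<Rightarrow> nat list \<Rightarrow> real mat set" where
  "block_fw2 n ks = {Z \<in> sym_mats n. \<exists>X :: nat \<Rightarrow> nat \<Rightarrow> real mat.
     (\<forall>j < length ks. \<forall>i < j. X i j \<in> psd_mats (ks ! i + ks ! j)) \<and>
     Z = (\<Oplus>\<^bsub>module_mat TYPE(real) n n\<^esub> i \<in> {0..<length ks - 1}.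
            \<Oplus>\<^bsub>module_mat TYPE(real) n n\<^esub> j \<in> {i + 1..<length ks}.
              (block_row_pair n ks i j)\<^sup>T * X i j * block_row_pair n ks i j)}"

definition factor_width_le :: "nat \<Rightarrow> nat \<Rightarrow> real mat set" where
  "factor_width_le k n = {V * V\<^sup>T | V m. V \<in> carrier_mat n m \<and>
     (\<forall>j < m. card {i. i < n \<and> V $$ (i, j) \<noteq> 0} \<le> k)}"

definition mat_trace :: "real mat \<Rightarrow> real" where
  "mat_trace A = (\<Sum>i < dim_row A. A $$ (i, i))"

definition dual_cone :: "nat \<Rightarrow> real mat set \<Rightarrow> real mat set" where
  "dual_cone n K = {X \<in> sym_mats n. \<forall>Z \<in> K. 0 \<le> mat_trace (X * Z)}"

end

theory Submission
  imports Defs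
begin

text \<open>All cones involved are generated by rank-one matrices \<open>v v\<^sup>T\<close>. Cholesky elimination writes a PSD
  matrix as a sum of such terms whose supports lie in the support of the matrix, so that
  \<open>block_fw2 n ks\<close> consists of the sums of \<open>v v\<^sup>T\<close> where the support of \<open>v\<close> meets at most two blocks.
  This condition weakens when blocks are merged, is vacuous for two blocks, and says that \<open>v\<close> has at
  most two nonzero entries for the trivial partition. The dual chain follows from
  \<open>tr (X v v\<^sup>T) = v\<^sup>T X v\<close>.\<close>

text \<open>The matrix \<open>V V^T\<close> whose columns are the listed vectors. Vectors are
  functions read only below \<open>n\<close>, and adding two such matrices is concatenation of
  lists.\<close>

definition gram :: "nat \<Rightarrow> (nat \<Rightarrow> real) list \<Rightarrow> real mat" where
  "gram n vs = mat n n (\<lambda>(r, c). \<Sum>v\<leftarrow>vs. v r * v c)"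

definition block :: "nat list \<Rightarrow> nat \<Rightarrow> nat set" where
  "block ks i = {sum_list (take i ks)..<sum_list (take (Suc i) ks)}"

text \<open>The strict \<open>i < j\<close> mirrors the pairs summed over in
  \<open>block_fw2\<close>. A vector living in a single block qualifies by adding any second
  block.\<close>

definition two_block_vector :: "nat \<Rightarrow> nat list \<Rightarrow> (nat \<Rightarrow> real) \<Rightarrow> bool" where
  "two_block_vector n ks v \<longleftrightarrow>
     (\<exists>i j. i < j \<and> j < length ks \<and> {r. r < n \<and> v r \<noteq> 0} \<subseteq> block ks i \<union> block ks j)"

definition quad_form :: "nat \<Rightarrow> real mat \<Rightarrow> (nat \<Rightarrow> real) \<Rightarrow> real" where
  "quad_form n Z x = (\<Sum>r<n. \<Sum>c<n. x r * Z $$ (r, c) * x c)"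

section \<open>Symmetric and positive semidefinite matrices\<close>

lemma sym_mats_iff:
  "Z \<in> sym_mats n \<longleftrightarrow> Z \<in> carrier_mat n n \<and> (\<forall>r<n. \<forall>c<n. Z $$ (r, c) = Z $$ (c, r))"
  by (auto simp: sym_mats_def intro!: eq_matI) (metis carrier_matD index_transpose_mat(1))

lemma scalar_prod_mult_mat_vec:
  assumes "Z \<in> carrier_mat n n" "v \<in> carrier_vec n"
  shows "v \<bullet> (Z *\<^sub>v v) = quad_form n Z (($) v)"
  using assms
  by (auto simp: scalar_prod_def quad_form_def sum_distrib_left atLeast0LessThan mult.assoc
      intro!: sum.cong)

lemma psd_mats_iff:
  "Z \<in> psd_mats n \<longleftrightarrow> Z \<in> sym_mats n \<and> (\<forall>x. 0 \<le> quad_form n Z x)" (is "?L \<longleftrightarrow> ?R")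
proof
  assume L: ?L
  have "0 \<le> quad_form n Z x" for x
  proof -
    have "Z \<in> carrier_mat n n" using L by (auto simp: psd_mats_def sym_mats_def)
    then have "quad_form n Z x = vec n x \<bullet> (Z *\<^sub>v vec n x)"
      by (simp add: scalar_prod_mult_mat_vec quad_form_def)
    also have "\<dots> \<ge> 0" using L by (simp add: psd_mats_def)
    finally show ?thesis .
  qed
  then show ?R using L by (simp add: psd_mats_def)
next
  assume ?R
  then show ?L
    by (auto simp: psd_mats_def sym_mats_def scalar_prod_mult_mat_vec)
qed

lemma psd_mats_carrier: "Z \<in> psd_mats n \<Longrightarrow> Z \<in> carrier_mat n n"
  by (simp add: psd_mats_def sym_mats_def)

lemma psd_mats_commute:
  "Z \<in> psd_mats n \<Longrightarrow> r < n \<Longrightarrow> c < n \<Longrightarrow> Z $$ (r, c) = Z $$ (c, r)"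
  by (simp add: psd_mats_iff sym_mats_iff)

lemma zero_psd_mats: "0\<^sub>m n n \<in> psd_mats n"
  by (simp add: psd_mats_iff sym_mats_iff quad_form_def)

lemma sym_mats_add: "A \<in> sym_mats n \<Longrightarrow> B \<in> sym_mats n \<Longrightarrow> A + B \<in> sym_mats n"
  by (auto simp: sym_mats_iff)

lemma psd_mats_add: "A \<in> psd_mats n \<Longrightarrow> B \<in> psd_mats n \<Longrightarrow> A + B \<in> psd_mats n"
  by (auto simp: psd_mats_iff sym_mats_iff quad_form_def algebra_simps sum.distrib add_nonneg_nonneg)

text \<open>The form of \<open>E^T X E\<close> at \<open>v\<close> is the form of \<open>X\<close>
  at \<open>E v\<close>. Serves both to embed a block into an \<open>n\<close> by \<open>n\<close>
  matrix and, with \<open>E\<close> transposed, to cut a block out.\<close>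

lemma psd_mats_congruence:
  assumes X: "X \<in> psd_mats m" and E: "E \<in> carrier_mat m n"
  shows "E\<^sup>T * X * E \<in> psd_mats n"
proof -
  have Xc: "X \<in> carrier_mat m m" and Xt: "X\<^sup>T = X"
    using X by (auto simp: psd_mats_def sym_mats_def)
  have "(E\<^sup>T * X * E)\<^sup>T = E\<^sup>T * (E\<^sup>T * X)\<^sup>T"
    by (rule transpose_mult) (use E Xc in auto)
  also have "(E\<^sup>T * X)\<^sup>T = X * E"
    using E Xc Xt by (subst transpose_mult) auto
  finally have "(E\<^sup>T * X * E)\<^sup>T = E\<^sup>T * X * E"
    using E Xc by (simp add: assoc_mult_mat[of "E\<^sup>T" n m X m E n])
  moreover have "0 \<le> v \<bullet> ((E\<^sup>T * X * E) *\<^sub>v v)" if v: "v \<in> carrier_vec n" for v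
  proof -
    have "(E\<^sup>T * X * E) *\<^sub>v v = E\<^sup>T *\<^sub>v (X *\<^sub>v (E *\<^sub>v v))"
      using E Xc v
      by (simp add: assoc_mult_mat_vec[of "E\<^sup>T" n m "X * E" n] assoc_mult_mat_vec[of X m m E n])
    moreover have "v \<bullet> (E\<^sup>T *\<^sub>v (X *\<^sub>v (E *\<^sub>v v))) = (E *\<^sub>v v) \<bullet> (X *\<^sub>v (E *\<^sub>v v))"
      using transpose_vec_mult_scalar[OF E v, of "X *\<^sub>v (E *\<^sub>v v)"] E Xc v
      by (metis comm_scalar_prod mult_mat_vec_carrier transpose_carrier_mat)
    ultimately show ?thesis
      using X E v by (auto simp: psd_mats_def)
  qed
  ultimately show ?thesis
    using E Xc by (auto simp: psd_mats_def sym_mats_def)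
qed

section \<open>The quadratic form along a coordinate line\<close>

lemma sum_indicator_mult:
  fixes f :: "nat \<Rightarrow> real"
  assumes "i < n"
  shows "(\<Sum>r<n. (if r = i then t else 0) * f r) = t * f i"
proof -
  have "(\<Sum>r<n. (if r = i then t else 0) * f r) = (\<Sum>r<n. if r = i then t * f r else 0)"
    by (intro sum.cong) auto
  then show ?thesis using assms by (simp add: sum.delta)
qed

text \<open>Symmetry merges the two cross terms into the factor 2. A suitable \<open>t\<close>
  yields a negative value in \<open>psd_zero_diag_row\<close> and the minimum over the line in
  \<open>psd_eq_gram\<close>.\<close>

lemma quad_form_line:
  assumes Z: "Z \<in> sym_mats n" and i: "i < n"
  shows "quad_form n Z (\<lambda>r. x r + (if r = i then t else 0)) =
    quad_form n Z x + 2 * t * (\<Sum>c<n. Z $$ (i, c) * x c) + t\<^sup>2 * Z $$ (i, i)"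
proof -
  define e where "e = (\<lambda>r. if r = i then t else 0)"
  have e: "(\<Sum>r<n. e r * f r) = t * f i" for f
    using sum_indicator_mult[OF i] by (simp add: e_def)
  have "quad_form n Z (\<lambda>r. x r + e r) = (\<Sum>r<n. \<Sum>c<n. x r * Z $$ (r, c) * x c
      + e r * (Z $$ (r, c) * x c) + e c * (Z $$ (r, c) * x r) + e r * (e c * Z $$ (r, c)))"
    unfolding quad_form_def by (intro sum.cong refl) (simp only: ring_distribs mult_ac add_ac)
  also have "\<dots> = quad_form n Z x + (\<Sum>r<n. \<Sum>c<n. e r * (Z $$ (r, c) * x c))
      + (\<Sum>r<n. \<Sum>c<n. e c * (Z $$ (r, c) * x r)) + (\<Sum>r<n. \<Sum>c<n. e r * (e c * Z $$ (r, c)))"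
    by (simp only: quad_form_def sum.distrib)
  also have "(\<Sum>r<n. \<Sum>c<n. e r * (Z $$ (r, c) * x c)) = t * (\<Sum>c<n. Z $$ (i, c) * x c)"
    by (simp only: e sum_distrib_left[symmetric])
  also have "(\<Sum>r<n. \<Sum>c<n. e c * (Z $$ (r, c) * x r)) = (\<Sum>r<n. t * (Z $$ (i, r) * x r))"
    using Z i by (intro sum.cong refl) (auto simp: e sym_mats_iff)
  also have "(\<Sum>r<n. \<Sum>c<n. e r * (e c * Z $$ (r, c))) = t * (t * Z $$ (i, i))"
    by (simp only: e sum_distrib_left[symmetric])
  finally show ?thesis
    by (simp add: e_def power2_eq_square sum_distrib_left[symmetric])
qed

lemma quad_form_unit: "c < n \<Longrightarrow> quad_form n Z (\<lambda>r. if r = c then 1 else 0) = Z $$ (c, c)"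
  by (simp add: quad_form_def sum_indicator_mult mult.assoc sum_distrib_left[symmetric]
      mult.commute[of _ "if _ then _ else _"])

text \<open>With a zero diagonal entry the form is affine in the coordinate \<open>i\<close>, so
  staying nonnegative forces the slope to vanish.\<close>

lemma psd_zero_diag_row:
  assumes Z: "Z \<in> psd_mats n" and i: "i < n" and c: "c < n" and zero: "Z $$ (i, i) = 0"
  shows "Z $$ (i, c) = 0"
proof (rule ccontr)
  assume nz: "Z $$ (i, c) \<noteq> 0"
  \<comment> \<open>Solves \<open>Z $$ (c, c) + 2 * t * Z $$ (i, c) = -1\<close>.\<close>
  define t where "t = - (Z $$ (c, c) + 1) / (2 * Z $$ (i, c))"
  let ?u = "\<lambda>r. if r = c then 1 else 0 :: real"
  have "0 \<le> quad_form n Z (\<lambda>r. ?u r + (if r = i then t else 0))"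
    using Z by (simp only: psd_mats_iff)
  also have "\<dots> = Z $$ (c, c) + 2 * t * Z $$ (i, c)"
    using Z i c zero
    by (subst quad_form_line)
      (simp_all add: psd_mats_iff quad_form_unit sum_indicator_mult mult.commute[of _ "if _ then _ else _"])
  also have "\<dots> = - 1" using nz by (simp add: t_def field_simps)
  finally show False by simp
qed

lemma psd_diag_nonneg: "Z \<in> psd_mats n \<Longrightarrow> i < n \<Longrightarrow> 0 \<le> Z $$ (i, i)"
  by (metis psd_mats_iff quad_form_unit)

section \<open>Gram matrices and Cholesky elimination\<close>

lemma gram_carrier [simp]: "gram n vs \<in> carrier_mat n n"
  by (simp add: gram_def)

lemma gram_index: "r < n \<Longrightarrow> c < n \<Longrightarrow> gram n vs $$ (r, c) = (\<Sum>v\<leftarrow>vs. v r * v c)"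
  by (simp add: gram_def)

lemma gram_Nil: "gram n [] = 0\<^sub>m n n"
  by (auto simp: gram_def)

lemma gram_append: "gram n (us @ vs) = gram n us + gram n vs"
  by (auto simp: gram_def)

lemma quad_form_gram: "quad_form n (gram n vs) x = (\<Sum>v\<leftarrow>vs. (\<Sum>r<n. v r * x r)\<^sup>2)"
proof -
  have "(\<Sum>r<n. \<Sum>c<n. x r * (\<Sum>v\<leftarrow>vs. v r * v c) * x c) = (\<Sum>v\<leftarrow>vs. (\<Sum>r<n. v r * x r)\<^sup>2)"
    by (induction vs)
      (simp_all add: algebra_simps sum.distrib power2_eq_square sum_product)
  then show ?thesis by (simp add: quad_form_def gram_index)
qed

lemma gram_psd: "gram n vs \<in> psd_mats n"
proof -
  have "0 \<le> (\<Sum>v\<leftarrow>vs. (\<Sum>r<n. v r * x r)\<^sup>2)" for x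
    by (rule sum_list_nonneg) auto
  then show ?thesis
    by (simp add: psd_mats_iff sym_mats_iff quad_form_gram gram_index mult.commute)
qed

text \<open>One step of Cholesky elimination at a positive diagonal entry zeroes that entry and
  creates no new nonzero diagonal entries, so the induction is on their number.\<close>

lemma psd_eq_gram:
  assumes "Z \<in> psd_mats n"
  shows "\<exists>vs. Z = gram n vs \<and> (\<forall>v\<in>set vs. \<forall>r<n. v r \<noteq> 0 \<longrightarrow> Z $$ (r, r) \<noteq> 0)"
  using assms
proof (induction "card {r. r < n \<and> Z $$ (r, r) \<noteq> 0}" arbitrary: Z rule: less_induct)
  case less
  show ?case
  proof (cases "\<exists>i<n. Z $$ (i, i) \<noteq> 0")
    case False
    \<comment> \<open>A vanishing diagonal kills every row, so \<open>Z\<close> is zero and the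
      empty list works.\<close>
    then have "Z = gram n []"
      using less.prems psd_zero_diag_row[OF less.prems] psd_mats_carrier[OF less.prems]
      by (auto simp: gram_Nil intro!: eq_matI)
    then show ?thesis by (intro exI[of _ "[]"]) simp
  next
    case True
    then obtain i where i: "i < n" "Z $$ (i, i) \<noteq> 0" by blast
    define d where "d = Z $$ (i, i)"
    have d: "d > 0" using psd_diag_nonneg[OF less.prems i(1)] i(2) by (simp add: d_def)
    \<comment> \<open>Scaled so that \<open>z z^T\<close> agrees with \<open>Z\<close> in row and
      column \<open>i\<close>; the remainder \<open>W\<close> is the Schur complement padded with
      zeros.\<close>
    define z where "z = (\<lambda>r. Z $$ (i, r) / sqrt d)"
    define W where "W = mat n n (\<lambda>(r, c). Z $$ (r, c) - z r * z c)"
    have ZW: "Z = gram n [z] + W"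
      using psd_mats_carrier[OF less.prems] by (auto simp: W_def gram_def)
    have zz: "z r * z c = Z $$ (i, r) * Z $$ (i, c) / d" for r c
      using d by (simp add: z_def)
    have "0 \<le> quad_form n W x" for x
    proof -
      define s where "s = (\<Sum>c<n. Z $$ (i, c) * x c)"
      have "quad_form n W x = quad_form n Z x - (\<Sum>r<n. \<Sum>c<n. x r * (z r * z c) * x c)"
        by (simp add: quad_form_def W_def algebra_simps sum_subtractf)
      also have "(\<Sum>r<n. \<Sum>c<n. x r * (z r * z c) * x c) = s\<^sup>2 / d"
        by (simp add: zz s_def power2_eq_square sum_product sum_divide_distrib algebra_simps)
      \<comment> \<open>Completing the square: \<open>- s / d\<close> minimises the form of
        \<open>Z\<close> over coordinate \<open>i\<close>, and the form of \<open>W\<close> is that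
        minimum, hence a value of a nonnegative form.\<close>
      also have "quad_form n Z x - s\<^sup>2 / d
          = quad_form n Z x + 2 * (- s / d) * s + (- s / d)\<^sup>2 * Z $$ (i, i)"
        using d by (simp add: d_def[symmetric] power2_eq_square)
      also have "\<dots> = quad_form n Z (\<lambda>r. x r + (if r = i then - s / d else 0))"
        using less.prems i(1) by (subst quad_form_line) (simp_all add: psd_mats_iff s_def)
      also have "\<dots> \<ge> 0" using less.prems by (simp only: psd_mats_iff)
      finally show ?thesis .
    qed
    then have W: "W \<in> psd_mats n"
      using psd_mats_commute[OF less.prems]
      by (simp add: psd_mats_iff sym_mats_iff W_def mult.commute)
    \<comment> \<open>No new support appears in \<open>z\<close> or on the diagonal of
      \<open>W\<close>. This gives both the decreasing measure and the support claim for
      \<open>z # vs\<close>.\<close>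
    have zW: "z r = 0 \<and> W $$ (r, r) = 0" if "r < n" "Z $$ (r, r) = 0" for r
      using psd_zero_diag_row[OF less.prems that(1) i(1) that(2)]
        psd_mats_commute[OF less.prems that(1) i(1)] that
      by (simp add: W_def z_def)
    have "W $$ (i, i) = 0" using i(1) d by (simp add: W_def zz d_def)
    then have "{r. r < n \<and> W $$ (r, r) \<noteq> 0} \<subset> {r. r < n \<and> Z $$ (r, r) \<noteq> 0}"
      using zW i by blast
    then have "card {r. r < n \<and> W $$ (r, r) \<noteq> 0} < card {r. r < n \<and> Z $$ (r, r) \<noteq> 0}"
      by (intro psubset_card_mono) auto
    from less.hyps[OF this W] obtain vs where vs: "W = gram n vs"
      "\<forall>v\<in>set vs. \<forall>r<n. v r \<noteq> 0 \<longrightarrow> W $$ (r, r) \<noteq> 0" by blast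
    have "Z = gram n (z # vs)" using ZW vs(1) gram_append[of n "[z]" vs] by simp
    moreover have "\<forall>v\<in>set (z # vs). \<forall>r<n. v r \<noteq> 0 \<longrightarrow> Z $$ (r, r) \<noteq> 0"
      using vs(2) zW by auto
    ultimately show ?thesis by blast
  qed
qed

lemma psd_mats_eq_gram: "psd_mats n = range (gram n)"
  using psd_eq_gram gram_psd by blast

section \<open>Traces and dual cones\<close>

lemma mat_trace_mult_gram:
  assumes X: "X \<in> carrier_mat n n"
  shows "mat_trace (X * gram n vs) = (\<Sum>v\<leftarrow>vs. quad_form n X v)"
proof -
  have "mat_trace (X * gram n vs) = (\<Sum>r<n. \<Sum>c<n. X $$ (r, c) * (\<Sum>v\<leftarrow>vs. v c * v r))"
    using X by (auto simp: mat_trace_def scalar_prod_def gram_index atLeast0LessThan gram_def)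
  also have "\<dots> = (\<Sum>v\<leftarrow>vs. quad_form n X v)"
    by (induction vs) (simp_all add: algebra_simps sum.distrib quad_form_def)
  finally show ?thesis .
qed

text \<open>Testing \<open>X\<close> against a single \<open>x x^T\<close> yields its form at
  \<open>x\<close>; conversely every PSD matrix is a Gram matrix, whose trace against
  \<open>X\<close> is a sum of values of that form.\<close>

lemma dual_cone_psd_mats: "dual_cone n (psd_mats n) = psd_mats n"
proof (intro equalityI subsetI)
  fix X assume X: "X \<in> dual_cone n (psd_mats n)"
  then have c: "X \<in> carrier_mat n n" by (simp add: dual_cone_def sym_mats_def)
  have "0 \<le> quad_form n X x" for x
    using X gram_psd[of n "[x]"] mat_trace_mult_gram[OF c, of "[x]"] by (auto simp: dual_cone_def)
  then show "X \<in> psd_mats n" using X by (simp add: psd_mats_iff dual_cone_def)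
next
  fix X assume X: "X \<in> psd_mats n"
  have "0 \<le> (\<Sum>v\<leftarrow>vs. quad_form n X v)" for vs
    using X by (intro sum_list_nonneg) (auto simp: psd_mats_iff)
  then show "X \<in> dual_cone n (psd_mats n)"
    using X by (auto simp: dual_cone_def psd_mats_eq_gram mat_trace_mult_gram psd_mats_carrier)
      (simp add: gram_psd psd_mats_iff[THEN iffD1] flip: psd_mats_eq_gram)
qed

lemma dual_cone_antimono: "K \<subseteq> L \<Longrightarrow> dual_cone n L \<subseteq> dual_cone n K"
  by (auto simp: dual_cone_def)

text \<open>\<open>V V^T\<close> is the sum of \<open>v v^T\<close> over the columns
  \<open>v\<close> of \<open>V\<close>, so a factor and a list of vectors carry the same
  data.\<close>

lemma factor_width_le_eq:
  "factor_width_le k n =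
    {gram n vs | vs. \<forall>v\<in>set vs. card {r. r < n \<and> v r \<noteq> 0} \<le> k}" (is "_ = ?R")
proof (intro equalityI subsetI)
  fix Z assume "Z \<in> factor_width_le k n"
  then obtain V m where V: "V \<in> carrier_mat n m" "Z = V * V\<^sup>T"
    "\<forall>j<m. card {r. r < n \<and> V $$ (r, j) \<noteq> 0} \<le> k"
    by (auto simp: factor_width_le_def)
  then have "Z = gram n (map (\<lambda>j r. V $$ (r, j)) [0..<m])"
    by (auto simp: gram_def scalar_prod_def o_def interv_sum_list_conv_sum_set_nat intro!: eq_matI)
  then show "Z \<in> ?R" using V(3) by force
next
  fix Z assume "Z \<in> ?R"
  then obtain vs where vs: "Z = gram n vs" "\<forall>v\<in>set vs. card {r. r < n \<and> v r \<noteq> 0} \<le> k" by auto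
  let ?V = "mat n (length vs) (\<lambda>(r, j). (vs ! j) r)"
  have "Z = ?V * ?V\<^sup>T"
    using vs(1)
    by (auto simp: gram_def scalar_prod_def sum_list_sum_nth intro!: eq_matI)
  moreover have "card {r. r < n \<and> ?V $$ (r, j) \<noteq> 0} \<le> k" if "j < length vs" for j
  proof -
    have "{r. r < n \<and> ?V $$ (r, j) \<noteq> 0} = {r. r < n \<and> (vs ! j) r \<noteq> 0}"
      using that by auto
    then show ?thesis using vs(2) that by auto
  qed
  ultimately show "Z \<in> factor_width_le k n"
    unfolding factor_width_le_def by (intro CollectI exI[of _ ?V] exI[of _ "length vs"]) auto
qed

section \<open>Sums in the module of square matrices\<close>

text \<open>Carrier membership travels with \<open>P\<close> because splitting off a summand
  requires it. A trivial \<open>P\<close> gives the carrier alone; \<open>block_fw2_eq\<close> takes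
  membership in a set of Gram matrices.\<close>

lemma finsum_mat_closed:
  assumes "finite F" "P (0\<^sub>m n n)" "\<And>A B. P A \<Longrightarrow> P B \<Longrightarrow> P (A + B)"
    and "\<And>i. i \<in> F \<Longrightarrow> f i \<in> carrier_mat n n \<and> P (f i)"
  shows "finsum (module_mat TYPE(real) n n) f F \<in> carrier_mat n n \<and>
    P (finsum (module_mat TYPE(real) n n) f F)"
proof -
  interpret M: abelian_group "module_mat TYPE(real) n n" by (rule abelian_group_mat)
  show ?thesis
    using assms(1,4)
  proof (induction F rule: finite_induct)
    case empty
    then show ?case using assms(2) by (simp add: module_mat_simps)
  next
    case (insert x F)
    then have "finsum (module_mat TYPE(real) n n) f (insert x F)
        = f x + finsum (module_mat TYPE(real) n n) f F"
      by (subst M.finsum_insert) (auto simp: module_mat_simps)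
    then show ?case using insert assms(3) by auto
  qed
qed

lemma index_finsum_mat:
  assumes "finite F" "\<And>i. i \<in> F \<Longrightarrow> f i \<in> carrier_mat n n" "r < n" "c < n"
  shows "finsum (module_mat TYPE(real) n n) f F $$ (r, c) = (\<Sum>i\<in>F. f i $$ (r, c))"
proof -
  interpret M: abelian_group "module_mat TYPE(real) n n" by (rule abelian_group_mat)
  show ?thesis
    using assms(1,2)
  proof (induction F rule: finite_induct)
    case empty
    then show ?case using assms(3,4) by (simp add: module_mat_simps)
  next
    case (insert x F)
    then have "finsum (module_mat TYPE(real) n n) f (insert x F)
        = f x + finsum (module_mat TYPE(real) n n) f F"
      by (subst M.finsum_insert) (auto simp: module_mat_simps)
    moreover have "finsum (module_mat TYPE(real) n n) f F \<in> carrier_mat n n"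
      using finsum_mat_closed[OF insert(1), of "\<lambda>_. True" n f] insert.prems by auto
    ultimately show ?case using insert assms(3,4) by auto
  qed
qed

section \<open>Blocks of indices and block rows\<close>

lemma sum_list_take_Suc: "i < length ks \<Longrightarrow> sum_list (take (Suc i) ks) = sum_list (take i ks) + ks ! i"
  for ks :: "nat list"
  by (simp add: take_Suc_conv_app_nth)

lemma sum_list_take_mono: "i \<le> j \<Longrightarrow> sum_list (take i ks) \<le> sum_list (take j ks)"
  for ks :: "nat list"
  by (metis le_add1 le_add_diff_inverse sum_list_append take_add)

lemma sum_list_take_le: "sum_list (take i ks) \<le> sum_list ks" for ks :: "nat list"
  by (metis append_take_drop_id le_add1 sum_list_append)

lemma block_disjoint: "i < j \<Longrightarrow> r \<in> block ks i \<Longrightarrow> r \<notin> block ks j"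
  using sum_list_take_mono[of "Suc i" j ks] by (auto simp: block_def)

lemma block_row_pair_carrier [simp]:
  "block_row_pair n ks i j \<in> carrier_mat (ks ! i + ks ! j) n"
  unfolding block_row_pair_def by (intro carrier_append_rows) (simp_all add: block_row_def)

text \<open>Local row \<open>a\<close> is the unit vector at its global position. That position must
  be shown to lie below \<open>n\<close> before the entry of the identity matrix can be
  evaluated.\<close>

lemma block_row_pair_index:
  assumes "sum_list ks = n" "i < length ks" "j < length ks" "a < ks ! i + ks ! j" "c < n"
  shows "block_row_pair n ks i j $$ (a, c) =
    (if (if a < ks ! i then sum_list (take i ks) + a else sum_list (take j ks) + (a - ks ! i)) = c
     then 1 else 0)"
proof -
  have "sum_list (take i ks) + a < n" if "a < ks ! i"
    using sum_list_take_le[of "Suc i" ks] sum_list_take_Suc[OF assms(2)] assms(1) that by simp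
  moreover have "sum_list (take j ks) + (a - ks ! i) < n" if "\<not> a < ks ! i"
    using sum_list_take_le[of "Suc j" ks] sum_list_take_Suc[OF assms(3)] assms(1,4) that by simp
  ultimately show ?thesis
    using assms(4,5) by (auto simp: block_row_pair_def append_rows_def block_row_def)
qed

lemma sum_lessThan_split: "(\<Sum>a<k + l. f a) = (\<Sum>a<k. f a) + (\<Sum>a<l. f (k + a))"
  for f :: "nat \<Rightarrow> real"
  by (induction l) (simp_all add: add.assoc)

lemma sum_shift_indicator:
  "(\<Sum>a<k. if s + a = r then 1 else 0) = (if r \<in> {s..<s + k} then 1 else 0 :: real)"
  for r s k :: nat
proof -
  \<comment> \<open>The guard \<open>s \<le> r\<close> protects against truncated subtraction in
    \<open>r - s\<close>.\<close>
  have "(\<Sum>a<k. if s + a = r then 1 else 0 :: real) = (\<Sum>a<k. if a = r - s \<and> s \<le> r then 1 else 0)"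
    by (intro sum.cong) auto
  also have "\<dots> = (if r \<in> {s..<s + k} then 1 else 0)"
    by (cases "s \<le> r") (auto simp: sum.delta)
  finally show ?thesis .
qed

text \<open>The rows of the pair are distinct unit vectors, so this product is the coordinate
  projection onto the two blocks.\<close>

lemma block_row_pair_gram:
  assumes "sum_list ks = n" "i < j" "j < length ks"
  shows "(block_row_pair n ks i j)\<^sup>T * block_row_pair n ks i j =
    mat n n (\<lambda>(r, c). if r = c \<and> r \<in> block ks i \<union> block ks j then 1 else 0)" (is "?E\<^sup>T * ?E = ?P")
proof (rule eq_matI)
  fix r c assume "r < dim_row ?P" "c < dim_col ?P"
  then have rc: "r < n" "c < n" by auto
  let ?k = "ks ! i" and ?l = "ks ! j"
  have ij: "i < length ks" "j < length ks" using assms by auto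
  have "(?E\<^sup>T * ?E) $$ (r, c) = (\<Sum>a<?k + ?l. ?E $$ (a, r) * ?E $$ (a, c))"
    using rc carrier_matD[OF block_row_pair_carrier[of n ks i j]]
    by (simp add: scalar_prod_def atLeast0LessThan)
  \<comment> \<open>A row has its only 1 in one column, so mixed products vanish, and a 0/1 entry
    equals its square.\<close>
  also have "\<dots> = (if r = c then \<Sum>a<?k + ?l. ?E $$ (a, r) else 0)"
    by (auto simp: block_row_pair_index[OF assms(1) ij _ rc(1)]
        block_row_pair_index[OF assms(1) ij _ rc(2)] intro!: sum.cong sum.neutral)
  also have "(\<Sum>a<?k + ?l. ?E $$ (a, r)) =
      (\<Sum>a<?k. if sum_list (take i ks) + a = r then 1 else 0) +
      (\<Sum>a<?l. if sum_list (take j ks) + a = r then 1 else 0)"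
    by (simp add: sum_lessThan_split block_row_pair_index[OF assms(1) ij _ rc(1)])
  \<comment> \<open>Disjointness of the blocks excludes the value 1 + 1.\<close>
  also have "\<dots> = (if r \<in> block ks i \<union> block ks j then 1 else 0)"
    using block_disjoint[OF assms(2), of r ks]
    by (simp add: sum_shift_indicator block_def sum_list_take_Suc ij)
  finally show "(?E\<^sup>T * ?E) $$ (r, c) = ?P $$ (r, c)"
    using rc by simp
qed (use carrier_matD[OF block_row_pair_carrier[of n ks i j]] in auto)

lemma block_row_pair_col_zero:
  assumes "sum_list ks = n" "i < length ks" "j < length ks" "a < ks ! i + ks ! j" "c < n"
    and "c \<notin> block ks i \<union> block ks j"
  shows "block_row_pair n ks i j $$ (a, c) = 0"
  using assms by (auto simp: block_row_pair_index block_def sum_list_take_Suc)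

section \<open>Single summands of the block decomposition\<close>

definition block_term :: "nat \<Rightarrow> nat list \<Rightarrow> nat \<Rightarrow> nat \<Rightarrow> real mat \<Rightarrow> real mat" where
  "block_term n ks i j X = (block_row_pair n ks i j)\<^sup>T * X * block_row_pair n ks i j"

lemma block_term_psd: "X \<in> psd_mats (ks ! i + ks ! j) \<Longrightarrow> block_term n ks i j X \<in> psd_mats n"
  unfolding block_term_def by (erule psd_mats_congruence) simp

text \<open>Diagonal entries suffice, since \<open>psd_eq_gram\<close> controls supports through the
  diagonal.\<close>

lemma block_term_diag_zero:
  assumes "sum_list ks = n" "i < length ks" "j < length ks" "r < n"
    and "r \<notin> block ks i \<union> block ks j" "X \<in> carrier_mat (ks ! i + ks ! j) (ks ! i + ks ! j)"
  shows "block_term n ks i j X $$ (r, r) = 0"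
  using assms carrier_matD[OF block_row_pair_carrier[of n ks i j]]
  by (simp add: block_term_def scalar_prod_def block_row_pair_col_zero)

lemma block_term_add:
  assumes X: "X \<in> carrier_mat (ks ! i + ks ! j) (ks ! i + ks ! j)"
    and Y: "Y \<in> carrier_mat (ks ! i + ks ! j) (ks ! i + ks ! j)"
  shows "block_term n ks i j (X + Y) = block_term n ks i j X + block_term n ks i j Y"
proof -
  let ?E = "block_row_pair n ks i j"
  have E: "?E\<^sup>T \<in> carrier_mat n (ks ! i + ks ! j)" by simp
  show ?thesis
    unfolding block_term_def mult_add_distrib_mat[OF E X Y]
    by (rule add_mult_distrib_mat[OF mult_carrier_mat[OF E X] mult_carrier_mat[OF E Y]
          block_row_pair_carrier])
qed

lemma block_term_zero:
  "block_term n ks i j (0\<^sub>m (ks ! i + ks ! j) (ks ! i + ks ! j)) = 0\<^sub>m n n"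
proof -
  have E: "(block_row_pair n ks i j)\<^sup>T \<in> carrier_mat n (ks ! i + ks ! j)" by simp
  show ?thesis
    unfolding block_term_def right_mult_zero_mat[OF E]
    by (rule left_mult_zero_mat[OF block_row_pair_carrier])
qed

text \<open>With \<open>P = E^T E\<close> the left side is \<open>P Z P\<close>, and the projection
  \<open>P\<close> fixes a matrix living on the two blocks. So such a matrix is recovered from its
  compression.\<close>

lemma block_term_compress:
  assumes "sum_list ks = n" "i < j" "j < length ks" and Z: "Z \<in> carrier_mat n n"
    and supp: "\<And>r c. r < n \<Longrightarrow> c < n \<Longrightarrow> Z $$ (r, c) \<noteq> 0 \<Longrightarrow>
      r \<in> block ks i \<union> block ks j \<and> c \<in> block ks i \<union> block ks j"
  shows "block_term n ks i j (block_row_pair n ks i j * Z * (block_row_pair n ks i j)\<^sup>T) = Z"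
proof -
  define E where "E = block_row_pair n ks i j"
  define m where "m = ks ! i + ks ! j"
  define P where "P = mat n n (\<lambda>(r, c). if r = c \<and> r \<in> block ks i \<union> block ks j then 1 else 0 :: real)"
  have E: "E \<in> carrier_mat m n" "E\<^sup>T \<in> carrier_mat n m" by (simp_all add: E_def m_def)
  have P: "E\<^sup>T * E = P" using block_row_pair_gram[OF assms(1-3)] by (simp add: E_def P_def)
  have Pc: "P \<in> carrier_mat n n" by (simp add: P_def)
  have ZE: "Z * E\<^sup>T \<in> carrier_mat n m" using Z E(2) by (rule mult_carrier_mat)
  have "E\<^sup>T * (E * Z * E\<^sup>T) * E = E\<^sup>T * (E * (Z * E\<^sup>T)) * E"
    by (simp only: assoc_mult_mat[OF E(1) Z E(2)])
  also have "\<dots> = P * (Z * E\<^sup>T) * E"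
    by (simp only: assoc_mult_mat[OF E(2) E(1) ZE, symmetric] P)
  also have "\<dots> = P * (Z * P)"
    by (simp only: assoc_mult_mat[OF Pc ZE E(1)] assoc_mult_mat[OF Z E(2) E(1)] P)
  also have "\<dots> = P * Z * P"
    by (rule assoc_mult_mat[OF Pc Z Pc, symmetric])
  also have "\<dots> = Z"
  proof (rule eq_matI)
    fix r c assume "r < dim_row Z" "c < dim_col Z"
    then have rc: "r < n" "c < n" using Z by auto
    have PZ: "(P * Z) $$ (r, d) = (if r \<in> block ks i \<union> block ks j then Z $$ (r, d) else 0)"
      if "d < n" for d
    proof -
      have "(P * Z) $$ (r, d) = (\<Sum>k = 0..<n. P $$ (r, k) * Z $$ (k, d))"
        using rc that Z Pc by (simp add: scalar_prod_def)
      also have "\<dots> = (\<Sum>k\<in>{r}. P $$ (r, k) * Z $$ (k, d))"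
        using rc by (intro sum.mono_neutral_right) (auto simp: P_def)
      finally show ?thesis using rc by (simp add: P_def)
    qed
    have "(P * Z * P) $$ (r, c) = (\<Sum>d = 0..<n. (P * Z) $$ (r, d) * P $$ (d, c))"
      using rc Z Pc by (simp add: scalar_prod_def del: assoc_mult_mat)
    also have "\<dots> = (\<Sum>d\<in>{c}. (P * Z) $$ (r, d) * P $$ (d, c))"
      using rc by (intro sum.mono_neutral_right) (auto simp: P_def)
    also have "\<dots> = Z $$ (r, c)"
      using rc supp[OF rc] by (cases "Z $$ (r, c) = 0") (simp_all add: PZ, simp add: P_def)
    finally show "(P * Z * P) $$ (r, c) = Z $$ (r, c)" .
  qed (use Z Pc in auto)
  finally show ?thesis by (simp add: block_term_def E_def)
qed

section \<open>Closure properties of the block cone\<close>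

text \<open>Comparing entries trades the module sums for real sums, where linearity and extraction
  of one summand are immediate.\<close>

lemma block_fw2_iff:
  "Z \<in> block_fw2 n ks \<longleftrightarrow> Z \<in> sym_mats n \<and> (\<exists>X.
     (\<forall>j < length ks. \<forall>i < j. X i j \<in> psd_mats (ks ! i + ks ! j)) \<and>
     (\<forall>r < n. \<forall>c < n. Z $$ (r, c) =
       (\<Sum>i = 0..<length ks - 1. \<Sum>j = i + 1..<length ks. block_term n ks i j (X i j) $$ (r, c))))"
proof -
  let ?M = "module_mat TYPE(real) n n"
  have "Z = (\<Oplus>\<^bsub>?M\<^esub> i \<in> {0..<length ks - 1}. \<Oplus>\<^bsub>?M\<^esub> j \<in> {i + 1..<length ks}. block_term n ks i j (X i j))
    \<longleftrightarrow> (\<forall>r < n. \<forall>c < n. Z $$ (r, c) =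
       (\<Sum>i = 0..<length ks - 1. \<Sum>j = i + 1..<length ks. block_term n ks i j (X i j) $$ (r, c)))"
    if Z: "Z \<in> sym_mats n" and X: "\<forall>j < length ks. \<forall>i < j. X i j \<in> psd_mats (ks ! i + ks ! j)" for X
  proof -
    have c1: "block_term n ks i j (X i j) \<in> carrier_mat n n" if "j \<in> {i + 1..<length ks}" for i j
      using X that by (intro psd_mats_carrier block_term_psd) auto
    let ?I = "\<lambda>i. \<Oplus>\<^bsub>?M\<^esub> j \<in> {i + 1..<length ks}. block_term n ks i j (X i j)"
    have c2: "?I i \<in> carrier_mat n n" for i
      using finsum_mat_closed[of "{i + 1..<length ks}" "\<lambda>_. True"] c1 by simp
    have c3: "(\<Oplus>\<^bsub>?M\<^esub> i \<in> {0..<length ks - 1}. ?I i) \<in> carrier_mat n n"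
      using finsum_mat_closed[of "{0..<length ks - 1}" "\<lambda>_. True"] c2 by simp
    have "(\<Oplus>\<^bsub>?M\<^esub> i \<in> {0..<length ks - 1}. ?I i) $$ (r, c) =
       (\<Sum>i = 0..<length ks - 1. \<Sum>j = i + 1..<length ks. block_term n ks i j (X i j) $$ (r, c))"
      if "r < n" "c < n" for r c
      by (subst index_finsum_mat[OF _ c2 that], simp, intro sum.cong refl index_finsum_mat[OF _ c1 that])
        simp_all
    moreover have "Z \<in> carrier_mat n n" using Z by (simp add: sym_mats_def)
    ultimately show ?thesis
      using c3 by (auto intro!: eq_matI)
  qed
  then show ?thesis
    unfolding block_fw2_def block_term_def[symmetric] mem_Collect_eq by blast
qed

lemma block_fw2_add:
  assumes "A \<in> block_fw2 n ks" "B \<in> block_fw2 n ks"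
  shows "A + B \<in> block_fw2 n ks"
proof -
  from assms obtain X Y where
    X: "\<forall>j < length ks. \<forall>i < j. X i j \<in> psd_mats (ks ! i + ks ! j)"
     "\<forall>r < n. \<forall>c < n. A $$ (r, c) =
       (\<Sum>i = 0..<length ks - 1. \<Sum>j = i + 1..<length ks. block_term n ks i j (X i j) $$ (r, c))"
    and Y: "\<forall>j < length ks. \<forall>i < j. Y i j \<in> psd_mats (ks ! i + ks ! j)"
     "\<forall>r < n. \<forall>c < n. B $$ (r, c) =
       (\<Sum>i = 0..<length ks - 1. \<Sum>j = i + 1..<length ks. block_term n ks i j (Y i j) $$ (r, c))"
    and AB: "A \<in> sym_mats n" "B \<in> sym_mats n"
    unfolding block_fw2_iff by blast
  have ABc: "A \<in> carrier_mat n n" "B \<in> carrier_mat n n"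
    using AB by (simp_all add: sym_mats_def)
  have "block_term n ks i j (X i j + Y i j) $$ (r, c) =
      block_term n ks i j (X i j) $$ (r, c) + block_term n ks i j (Y i j) $$ (r, c)"
    if "i + 1 \<le> j" "j < length ks" "r < n" "c < n" for i j r c
    using that X(1) Y(1) psd_mats_carrier[OF block_term_psd, of "Y i j" ks i j n]
    by (subst block_term_add) (auto intro: psd_mats_carrier)
  then have "(\<Sum>i = 0..<length ks - 1. \<Sum>j = i + 1..<length ks.
      block_term n ks i j (X i j + Y i j) $$ (r, c)) = (A + B) $$ (r, c)" if "r < n" "c < n" for r c
    using that X(2) Y(2) ABc by (simp add: sum.distrib)
  moreover have "\<forall>j < length ks. \<forall>i < j. X i j + Y i j \<in> psd_mats (ks ! i + ks ! j)"
    using X(1) Y(1) by (simp add: psd_mats_add)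
  ultimately show ?thesis
    unfolding block_fw2_iff using AB
    by (intro conjI sym_mats_add exI[of _ "\<lambda>i j. X i j + Y i j"]) auto
qed

lemma block_fw2_zero: "0\<^sub>m n n \<in> block_fw2 n ks"
  unfolding block_fw2_iff
  by (intro conjI exI[of _ "\<lambda>i j. 0\<^sub>m (ks ! i + ks ! j) (ks ! i + ks ! j)"])
    (simp_all add: zero_psd_mats block_term_zero sym_mats_iff)

lemma block_term_in_block_fw2:
  assumes ij: "i0 < j0" "j0 < length ks" and X: "X0 \<in> psd_mats (ks ! i0 + ks ! j0)"
  shows "block_term n ks i0 j0 X0 \<in> block_fw2 n ks"
proof -
  \<comment> \<open>All other pairs get the zero matrix of their own size, which is PSD and
    contributes nothing.\<close>
  define X where "X = (\<lambda>i j. if i = i0 \<and> j = j0 then X0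
    else 0\<^sub>m (ks ! i + ks ! j) (ks ! i + ks ! j))"
  have "(\<Sum>i = 0..<length ks - 1. \<Sum>j = i + 1..<length ks. block_term n ks i j (X i j) $$ (r, c))
      = block_term n ks i0 j0 X0 $$ (r, c)" if rc: "r < n" "c < n" for r c
  proof -
    have "block_term n ks i j (X i j) $$ (r, c) =
        (if i = i0 then if j = j0 then block_term n ks i0 j0 X0 $$ (r, c) else 0 else 0)" for i j
      using rc by (simp add: X_def block_term_zero)
    then have "(\<Sum>j = i + 1..<length ks. block_term n ks i j (X i j) $$ (r, c)) =
        (if i = i0 then block_term n ks i0 j0 X0 $$ (r, c) else 0)" for i
      using ij by (simp add: sum.delta)
    \<comment> \<open>From \<open>i0 < j0 < length ks\<close>, the index \<open>i0\<close> lies in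
      the outer range, which stops before \<open>length ks - 1\<close>.\<close>
    then show ?thesis using ij by (simp add: sum.delta)
  qed
  moreover have "\<forall>j < length ks. \<forall>i < j. X i j \<in> psd_mats (ks ! i + ks ! j)"
    using X by (simp add: X_def zero_psd_mats)
  moreover have "block_term n ks i0 j0 X0 \<in> sym_mats n"
    using block_term_psd[OF X] by (simp add: psd_mats_iff)
  ultimately show ?thesis unfolding block_fw2_iff by (intro conjI exI[of _ X]) auto
qed

section \<open>The block cone in terms of two-block vectors\<close>

text \<open>Each \<open>v v^T\<close> lives on two blocks, so it is the block term of its own
  compression; sums stay in the cone.\<close>

lemma gram_in_block_fw2:
  assumes "sum_list ks = n" "\<forall>v\<in>set vs. two_block_vector n ks v"
  shows "gram n vs \<in> block_fw2 n ks"
  using assms(2)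
proof (induction vs)
  case Nil
  then show ?case by (simp add: gram_Nil block_fw2_zero)
next
  case (Cons v vs)
  then obtain i j where ij: "i < j" "j < length ks"
    "{r. r < n \<and> v r \<noteq> 0} \<subseteq> block ks i \<union> block ks j"
    by (auto simp: two_block_vector_def)
  let ?E = "block_row_pair n ks i j"
  have "block_term n ks i j (?E * gram n [v] * ?E\<^sup>T) = gram n [v]"
    using ij by (intro block_term_compress assms(1)) (auto simp: gram_index)
  moreover have "?E * gram n [v] * ?E\<^sup>T \<in> psd_mats (ks ! i + ks ! j)"
    using psd_mats_congruence[OF gram_psd, of "?E\<^sup>T"] by simp
  ultimately have "gram n [v] \<in> block_fw2 n ks"
    using block_term_in_block_fw2[OF ij(1,2)] by metis
  then show ?case
    using Cons block_fw2_add gram_append[of n "[v]" vs] by simp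
qed

text \<open>Reduces all comparisons of cones to supports of vectors. Each block term is PSD with
  zero diagonal off its two blocks, so its Cholesky vectors are two-block vectors.\<close>

lemma block_fw2_eq:
  assumes "sum_list ks = n"
  shows "block_fw2 n ks = {gram n vs | vs. \<forall>v\<in>set vs. two_block_vector n ks v}" (is "_ = ?R")
proof (intro equalityI subsetI)
  fix Z assume "Z \<in> block_fw2 n ks"
  then obtain X where X: "\<forall>j < length ks. \<forall>i < j. X i j \<in> psd_mats (ks ! i + ks ! j)"
    and Z: "Z = (\<Oplus>\<^bsub>module_mat TYPE(real) n n\<^esub> i \<in> {0..<length ks - 1}.
            \<Oplus>\<^bsub>module_mat TYPE(real) n n\<^esub> j \<in> {i + 1..<length ks}. block_term n ks i j (X i j))"
    by (auto simp: block_fw2_def block_term_def)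
  have zero: "0\<^sub>m n n \<in> ?R" by (auto simp: gram_Nil[symmetric])
  have add: "A + B \<in> ?R" if AB: "A \<in> ?R" "B \<in> ?R" for A B
  proof -
    from AB obtain us vs where "A = gram n us" "B = gram n vs"
      "\<forall>v\<in>set us. two_block_vector n ks v" "\<forall>v\<in>set vs. two_block_vector n ks v" by blast
    then show ?thesis by (intro CollectI exI[of _ "us @ vs"]) (auto simp: gram_append)
  qed
  have single: "block_term n ks i j (X i j) \<in> carrier_mat n n \<and> block_term n ks i j (X i j) \<in> ?R"
    if "j \<in> {i + 1..<length ks}" for i j
  proof -
    have ij: "i < j" "i < length ks" "j < length ks" and Xij: "X i j \<in> psd_mats (ks ! i + ks ! j)"
      using X that by auto
    from psd_eq_gram[OF block_term_psd[OF Xij], of n] obtain vs where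
      vs: "block_term n ks i j (X i j) = gram n vs"
        "\<forall>v\<in>set vs. \<forall>r<n. v r \<noteq> 0 \<longrightarrow> block_term n ks i j (X i j) $$ (r, r) \<noteq> 0" by blast
    have "r \<in> block ks i \<union> block ks j" if "v \<in> set vs" "r < n" "v r \<noteq> 0" for v r
      using vs(2) that block_term_diag_zero[OF assms ij(2,3) that(2) _ psd_mats_carrier[OF Xij]]
      by blast
    then have "\<forall>v\<in>set vs. two_block_vector n ks v"
      unfolding two_block_vector_def using ij by blast
    then show ?thesis using vs(1) by auto
  qed
  have "Z \<in> carrier_mat n n \<and> Z \<in> ?R"
    unfolding Z by (intro finsum_mat_closed finite_atLeastLessThan zero add single)
  then show "Z \<in> ?R" by blast
next
  fix Z assume "Z \<in> ?R"
  then show "Z \<in> block_fw2 n ks" using gram_in_block_fw2[OF assms] by auto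
qed

section \<open>Passing to coarser partitions\<close>

text \<open>Allows \<open>i\<close> and \<open>j\<close> to coincide or come in the wrong order, as
  happens after merging blocks.\<close>

lemma two_block_vectorI:
  assumes "2 \<le> length ks" "i < length ks" "j < length ks"
    "{r. r < n \<and> v r \<noteq> 0} \<subseteq> block ks i \<union> block ks j"
  shows "two_block_vector n ks v"
proof -
  \<comment> \<open>If \<open>i = j\<close>, a different partner is taken from blocks 0 and 1, which
    exist as there are at least two blocks.\<close>
  define k where "k = (if i = j then if i = 0 then 1 else 0 else j)"
  have "i \<noteq> k" "k < length ks" using assms(1,3) by (auto simp: k_def)
  have sub: "{r. r < n \<and> v r \<noteq> 0} \<subseteq> block ks i \<union> block ks k"
    using assms(4) by (cases "i = j") (auto simp: k_def)
  have "min i k < max i k" "max i k < length ks"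
    using \<open>i \<noteq> k\<close> \<open>k < length ks\<close> assms(2) by (simp_all add: min_def max_def)
  moreover have "{r. r < n \<and> v r \<noteq> 0} \<subseteq> block ks (min i k) \<union> block ks (max i k)"
    using sub by (cases "i \<le> k") (simp_all add: min_def max_def Un_commute)
  ultimately show ?thesis
    unfolding two_block_vector_def by (intro exI conjI)
qed

lemma block_fw2_mono:
  assumes "sum_list ks = n" "sum_list ls = n" "2 \<le> length ls"
    and refine: "\<And>i. i < length ks \<Longrightarrow> \<exists>i'<length ls. block ks i \<subseteq> block ls i'"
  shows "block_fw2 n ks \<subseteq> block_fw2 n ls"
proof -
  have "two_block_vector n ls v" if v: "two_block_vector n ks v" for v
  proof -
    obtain i j where "i < j" "j < length ks"
      and supp: "{r. r < n \<and> v r \<noteq> 0} \<subseteq> block ks i \<union> block ks j"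
      using v unfolding two_block_vector_def by blast
    then have "i < length ks" by simp
    from refine[OF this] obtain i' where i': "i' < length ls" "block ks i \<subseteq> block ls i'" by blast
    from refine[OF \<open>j < length ks\<close>] obtain j' where j': "j' < length ls" "block ks j \<subseteq> block ls j'"
      by blast
    show ?thesis
      by (rule two_block_vectorI[OF assms(3) i'(1) j'(1) subset_trans[OF supp Un_mono[OF i'(2) j'(2)]]])
  qed
  then show ?thesis
    unfolding block_fw2_eq[OF assms(1)] block_fw2_eq[OF assms(2)]
    by (intro Collect_mono impI) (elim exE conjE, intro exI conjI ballI, assumption, blast)
qed

text \<open>Either \<open>i\<close> is already below \<open>m q\<close>, or it falls into the last
  gap. Applied to the cut points of a sub-partition and to prefix sums of block sizes.\<close>

lemma ex_between_cut_points:
  assumes "m 0 = (0::nat)" "i < m q"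
  shows "\<exists>i'<q. m i' \<le> i \<and> i < m (Suc i')"
  using assms
proof (induction q)
  case (Suc q)
  then show ?case by (cases "i < m q") (auto simp: less_Suc_eq)
qed simp

lemma block_in_block_of_cut_points:
  assumes "sum_list (take a ks) = sum_list (take i' ls)"
    "sum_list (take b ks) = sum_list (take (Suc i') ls)" "a \<le> i" "i < b"
  shows "block ks i \<subseteq> block ls i'"
  using assms sum_list_take_mono[of a i ks] sum_list_take_mono[of "Suc i" b ks]
  by (auto simp: block_def)

text \<open>The prefix sums of \<open>ls\<close> are those of \<open>ks\<close> at the cut points,
  so a fine block between two consecutive cuts lies inside one coarse block.\<close>

lemma sub_partition_refines:
  assumes "sub_partition ks ls" "i < length ks"
  shows "\<exists>i'<length ls. block ks i \<subseteq> block ls i'"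
proof -
  from assms obtain m where m: "m 0 = 0" "m (length ls) = length ks"
    "\<forall>i < length ls. m i < m (i + 1)"
    "\<forall>i < length ls. ls ! i = (\<Sum>j = m i..<m (i + 1). ks ! j)"
    by (auto simp: sub_partition_def)
  have prefix: "sum_list (take i' ls) = (\<Sum>j = 0..<m i'. ks ! j)" if "i' \<le> length ls" for i'
    using that
  proof (induction i')
    case (Suc i')
    then show ?case
      using m(3,4) sum.atLeastLessThan_concat[of 0 "m i'" "m (Suc i')" "(!) ks"]
      by (simp add: sum_list_take_Suc less_imp_le)
  qed (simp add: m(1))
  \<comment> \<open>Downward induction from \<open>m (length ls) = length ks\<close>. The bound
    ensures that \<open>take (m i') ks\<close> really has \<open>m i'\<close> elements.\<close>
  have m_le: "m i' \<le> length ks" if "i' \<le> length ls" for i'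
    using that
  proof (induction rule: inc_induct)
    case (step k)
    then show ?case using m(3) by (metis Suc_eq_plus1 less_imp_le order_trans)
  qed (simp add: m(2))
  have take: "sum_list (take (m i') ks) = sum_list (take i' ls)" if "i' \<le> length ls" for i'
    using prefix[OF that] m_le[OF that] by (simp add: sum_list_sum_nth min_absorb2)
  obtain i' where i': "i' < length ls" "m i' \<le> i" "i < m (Suc i')"
    using ex_between_cut_points[of m i "length ls"] m(1,2) assms(2) by auto
  then show ?thesis
    using block_in_block_of_cut_points[OF take take] by (intro exI[of _ i']) auto
qed

lemma block_trivial: "i < n \<Longrightarrow> block (replicate n (Suc 0)) i = {i}"
  by (auto simp: block_def min_def sum_list_replicate)

text \<open>Blocks of the trivial partition are singletons, and every index lies in some block. As
  \<open>sub_partition\<close> is strict, it would miss the case where \<open>ls\<close> is itself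
  trivial.\<close>

lemma trivial_partition_refines:
  assumes "i < sum_list ls"
  shows "\<exists>i'<length ls. block (replicate (sum_list ls) 1) i \<subseteq> block ls i'"
proof -
  obtain i' where "i' < length ls" "i \<in> block ls i'"
    using ex_between_cut_points[of "\<lambda>k. sum_list (take k ls)" i "length ls"] assms
    by (auto simp: block_def)
  then show ?thesis using assms by (auto simp: block_trivial)
qed

section \<open>The two ends of the chain\<close>

lemma block_fw2_two_blocks:
  assumes "a + b = n"
  shows "block_fw2 n [a, b] = psd_mats n"
proof -
  have "two_block_vector n [a, b] v" for v
    using assms unfolding two_block_vector_def
    by (intro exI[of _ 0] exI[of _ 1]) (auto simp: block_def)
  then show ?thesis using assms by (auto simp: block_fw2_eq psd_mats_eq_gram)
qed

lemma block_fw2_subset_psd_mats: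
  assumes "sum_list ks = n" shows "block_fw2 n ks \<subseteq> psd_mats n"
  using assms by (auto simp: block_fw2_eq gram_psd)

text \<open>For \<open>n < 2\<close> there is no pair \<open>i < j\<close> of blocks, so the
  equivalence would fail.\<close>

lemma two_block_vector_trivial:
  assumes "2 \<le> n"
  shows "two_block_vector n (replicate n 1) v \<longleftrightarrow> card {r. r < n \<and> v r \<noteq> 0} \<le> 2"
proof
  assume "two_block_vector n (replicate n 1) v"
  then obtain i j where "{r. r < n \<and> v r \<noteq> 0} \<subseteq> {i, j}"
    by (auto simp: two_block_vector_def block_trivial)
  then have "card {r. r < n \<and> v r \<noteq> 0} \<le> card {i, j}" by (intro card_mono) auto
  also have "\<dots> \<le> 2" by (simp add: card_insert_if)
  finally show "card {r. r < n \<and> v r \<noteq> 0} \<le> 2" .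
next
  let ?S = "{r. r < n \<and> v r \<noteq> 0}"
  assume le: "card ?S \<le> 2"
  have "\<exists>i<n. \<exists>j<n. ?S \<subseteq> {i, j}"
  proof -
    consider "card ?S = 0" | "card ?S = 1" | "card ?S = 2" using le by linarith
    then show ?thesis
    proof cases
      case 1
      then have "?S = {}" by simp
      \<comment> \<open>Index 0 serves as a default for the empty support.\<close>
      then have "?S \<subseteq> {0, 0}" by (simp only: empty_subsetI)
      moreover have "0 < n" using assms by simp
      ultimately show ?thesis by blast
    next
      case 2
      then obtain i where "?S = {i}" by (rule card_1_singletonE)
      then show ?thesis by blast
    next
      case 3
      then obtain i j where "?S = {i, j}" by (auto simp: card_2_iff)
      then show ?thesis by blast
    qed
  qed
  then obtain i j where "i < n" "j < n" "?S \<subseteq> {i, j}" by blast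
  then show "two_block_vector n (replicate n 1) v"
    using assms by (intro two_block_vectorI[of _ i j]) (auto simp: block_trivial)
qed

theorem theorem2:
  fixes n n\<^sub>1 n\<^sub>2 :: nat and \<alpha> \<beta> :: "nat list"
  assumes "is_partition n \<alpha>" and "is_partition n \<beta>" and "is_partition n [n\<^sub>1, n\<^sub>2]"
    and "sub_partition \<alpha> \<beta>"
  shows "factor_width_le 2 n = block_fw2 n (replicate n 1) \<and>
         block_fw2 n (replicate n 1) \<subseteq> block_fw2 n \<alpha> \<and>
         block_fw2 n \<alpha> \<subseteq> block_fw2 n \<beta> \<and>
         block_fw2 n \<beta> \<subseteq> block_fw2 n [n\<^sub>1, n\<^sub>2] \<and>
         block_fw2 n [n\<^sub>1, n\<^sub>2] = psd_mats n \<and>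
         psd_mats n = dual_cone n (block_fw2 n [n\<^sub>1, n\<^sub>2]) \<and>
         dual_cone n (block_fw2 n [n\<^sub>1, n\<^sub>2]) \<subseteq> dual_cone n (block_fw2 n \<beta>) \<and>
         dual_cone n (block_fw2 n \<beta>) \<subseteq> dual_cone n (block_fw2 n \<alpha>) \<and>
         dual_cone n (block_fw2 n \<alpha>) \<subseteq> dual_cone n (block_fw2 n (replicate n 1))"
proof -
  have \<alpha>: "sum_list \<alpha> = n" "2 \<le> length \<alpha>" and \<beta>: "sum_list \<beta> = n" "2 \<le> length \<beta>"
    and \<gamma>: "n\<^sub>1 + n\<^sub>2 = n" "0 < n\<^sub>1" "0 < n\<^sub>2"
    using assms by (auto simp: is_partition_def)
  have "2 \<le> n" using \<gamma> by simp
  then have fw: "factor_width_le 2 n = block_fw2 n (replicate n 1)"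
    by (simp only: factor_width_le_eq two_block_vector_trivial
        block_fw2_eq[of "replicate n 1"] sum_list_replicate mult_1_right of_nat_id)
  have "block_fw2 n (replicate n 1) \<subseteq> block_fw2 n \<alpha>"
    using trivial_partition_refines[of _ \<alpha>] \<alpha>
    by (intro block_fw2_mono) (simp_all add: sum_list_replicate)
  moreover have "block_fw2 n \<alpha> \<subseteq> block_fw2 n \<beta>"
    using sub_partition_refines[OF assms(4)] \<alpha> \<beta> by (intro block_fw2_mono) auto
  moreover have "block_fw2 n \<beta> \<subseteq> psd_mats n"
    by (rule block_fw2_subset_psd_mats[OF \<beta>(1)])
  \<comment> \<open>Dualising reverses the inclusions. Self-duality turns the dual for
    \<open>[n\<^sub>1, n\<^sub>2]\<close> into \<open>psd_mats n\<close>, so its inclusion in the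
    dual for \<beta> reads \<open>dual_cone_psd_mats\<close> backwards.\<close>
  ultimately show ?thesis
    using fw by (simp add: block_fw2_two_blocks[OF \<gamma>(1)] dual_cone_psd_mats dual_cone_antimono
        del: One_nat_def) (metis dual_cone_antimono dual_cone_psd_mats)
qed

end
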